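(* Let $R$ be a finite Abelian group endowed with a binary operation $\circ:R\times R\to R$ that is distributive over addition on both sides (a possibly non-associative ring). Let $R\star R$ denote the set $R\times R$ with the group operation $(x,y)\star(x',y')=(x+x',\,y+y'+x\circ x')$, and let $U(R)$ be the set of all $a\in R$ such that the map $R\to R$, $x\mapsto x\circ a$, is bijective. Then the set $B=\{(x,x\circ x):x\in R\}$ is a difference basis for the set $U(R)\times R$ in the group $R\star R$, i.e. every $g\in U(R)\times R$ can be written as $g=b_1\star b_2^{-1}$ with $b_1,b_2\in B$.
   Context: In the group $R\star R$ the identity is $(0,0)$ and the inverse of $(x,y)$ is $(-x,-y+x\circ x)$. *)

theory Defs
  imports "HOL-Algebra.Ring"
begin

text \<open>
  An Abelian group with a biadditive product. Associativity, commutativity and a unit of the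
  product are not assumed: the field \<open>one\<close> of the ring record is left completely unconstrained.
\<close>

locale nonassoc_ring = abelian_group R for R (structure) +
  assumes m_closed: "\<lbrakk>x \<in> carrier R; y \<in> carrier R\<rbrakk> \<Longrightarrow> x \<otimes> y \<in> carrier R"
    and l_distr: "\<lbrakk>x \<in> carrier R; y \<in> carrier R; z \<in> carrier R\<rbrakk>
                  \<Longrightarrow> (x \<oplus> y) \<otimes> z = x \<otimes> z \<oplus> y \<otimes> z"
    and r_distr: "\<lbrakk>x \<in> carrier R; y \<in> carrier R; z \<in> carrier R\<rbrakk>
                  \<Longrightarrow> z \<otimes> (x \<oplus> y) = z \<otimes> x \<oplus> z \<otimes> y"

definition star_group :: "('a, 'm) ring_scheme \<Rightarrow> ('a \<times> 'a) monoid" where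
  "star_group R =
    \<lparr>carrier = carrier R \<times> carrier R,
     monoid.mult = (\<lambda>(x, y) (x', y'). (x \<oplus>\<^bsub>R\<^esub> x', y \<oplus>\<^bsub>R\<^esub> y' \<oplus>\<^bsub>R\<^esub> x \<otimes>\<^bsub>R\<^esub> x')),
     one = (\<zero>\<^bsub>R\<^esub>, \<zero>\<^bsub>R\<^esub>)\<rparr>"

definition right_bijective :: "('a, 'm) ring_scheme \<Rightarrow> 'a set" where
  "right_bijective R =
    {a \<in> carrier R. bij_betw (\<lambda>x. x \<otimes>\<^bsub>R\<^esub> a) (carrier R) (carrier R)}"

definition difference_basis :: "('g, 'm) monoid_scheme \<Rightarrow> 'g set \<Rightarrow> 'g set \<Rightarrow> bool" where
  "difference_basis G B A \<longleftrightarrow>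
    B \<subseteq> carrier G \<and> A \<subseteq> carrier G \<and>
    (\<forall>g\<in>A. \<exists>b\<^sub>1\<in>B. \<exists>b\<^sub>2\<in>B. g = b\<^sub>1 \<otimes>\<^bsub>G\<^esub> inv\<^bsub>G\<^esub> b\<^sub>2)"

lemma (in nonassoc_ring) minus_mult:
  assumes "x \<in> carrier R" "y \<in> carrier R"
  shows "(\<ominus> x) \<otimes> y = \<ominus> (x \<otimes> y)"
proof -
  have z: "\<zero> \<otimes> y = \<zero>"
    using l_distr[of \<zero> \<zero> y] m_closed[of \<zero> y] assms by (simp add: add.l_cancel_one)
  have "(\<ominus> x) \<otimes> y \<oplus> x \<otimes> y = \<zero>"
    using l_distr[of "\<ominus> x" x y] assms z by (simp add: l_neg)
  then show ?thesis
    using assms by (metis m_closed a_inv_closed minus_equality)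
qed

text \<open>The inverse in \<open>star_group R\<close> used by \<open>difference_basis\<close> is thus a genuine group inverse.\<close>

lemma (in nonassoc_ring) group_star_group: "group (star_group R)"
proof (rule groupI)
  fix p assume "p \<in> carrier (star_group R)"
  then obtain x y where p: "p = (x, y)" "x \<in> carrier R" "y \<in> carrier R"
    by (auto simp: star_group_def)
  have "(\<ominus> x, \<ominus> y \<oplus> x \<otimes> x) \<otimes>\<^bsub>star_group R\<^esub> p = \<one>\<^bsub>star_group R\<^esub>"
    using p m_closed[of x x] by (simp add: star_group_def minus_mult a_ac l_neg r_neg r_neg1 r_neg2)
  moreover have "(\<ominus> x, \<ominus> y \<oplus> x \<otimes> x) \<in> carrier (star_group R)"
    using p by (simp add: star_group_def m_closed)
  ultimately show "\<exists>q\<in>carrier (star_group R). q \<otimes>\<^bsub>star_group R\<^esub> p = \<one>\<^bsub>star_group R\<^esub>" by blast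
next
  fix p assume "p \<in> carrier (star_group R)"
  moreover have "\<zero> \<otimes> x = \<zero>" if "x \<in> carrier R" for x
    using l_distr[of \<zero> \<zero> x] m_closed[of \<zero> x] that by (simp add: add.l_cancel_one)
  ultimately show "\<one>\<^bsub>star_group R\<^esub> \<otimes>\<^bsub>star_group R\<^esub> p = p"
    by (auto simp: star_group_def)
qed (auto simp: star_group_def m_closed l_distr r_distr a_ac)

end

theory Submission
  imports Defs
begin

text \<open>
  The equation \<open>(a, c) = b\<^sub>1 \<star> b\<^sub>2\<inverse>\<close> with \<open>b\<^sub>2 = (y, y \<circ> y)\<close> and \<open>b\<^sub>1 = (a + y, (a + y) \<circ> (a + y))\<close>
  is equivalent to \<open>(a, c) \<star> b\<^sub>2 = b\<^sub>1\<close>, which after expanding both sides reduces to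
  \<open>y \<circ> a = c - a \<circ> a\<close>. This is solvable for \<open>y\<close> because \<open>x \<mapsto> x \<circ> a\<close> is onto.
\<close>

theorem theorem5p4:
  fixes R :: "('a, 'm) ring_scheme"
  assumes "nonassoc_ring R" and "finite (carrier R)"
  shows "difference_basis (star_group R)
           {(x, x \<otimes>\<^bsub>R\<^esub> x) | x. x \<in> carrier R}
           (right_bijective R \<times> carrier R)"
proof -
  interpret nonassoc_ring R by fact
  interpret S: group "star_group R" by (rule group_star_group)
  let ?B = "{(x, x \<otimes>\<^bsub>R\<^esub> x) | x. x \<in> carrier R}"
  have B: "?B \<subseteq> carrier (star_group R)"
    by (auto simp: star_group_def m_closed)
  have A: "right_bijective R \<times> carrier R \<subseteq> carrier (star_group R)"
    by (auto simp: star_group_def right_bijective_def)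
  have "\<exists>b\<^sub>1\<in>?B. \<exists>b\<^sub>2\<in>?B. (a, c) = b\<^sub>1 \<otimes>\<^bsub>star_group R\<^esub> inv\<^bsub>star_group R\<^esub> b\<^sub>2"
    if a: "a \<in> right_bijective R" and c: "c \<in> carrier R" for a c
  proof -
    have a': "a \<in> carrier R" and surj: "(\<lambda>x. x \<otimes>\<^bsub>R\<^esub> a) ` carrier R = carrier R"
      using a by (auto simp: right_bijective_def bij_betw_def)
    have aa: "a \<otimes>\<^bsub>R\<^esub> a \<in> carrier R"
      using a' m_closed by blast
    then have "c \<ominus>\<^bsub>R\<^esub> a \<otimes>\<^bsub>R\<^esub> a \<in> (\<lambda>x. x \<otimes>\<^bsub>R\<^esub> a) ` carrier R"
      using c surj by simp
    then obtain y where y: "y \<in> carrier R" and ya: "y \<otimes>\<^bsub>R\<^esub> a = c \<ominus>\<^bsub>R\<^esub> a \<otimes>\<^bsub>R\<^esub> a"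
      by auto
    let ?b1 = "(a \<oplus>\<^bsub>R\<^esub> y, (a \<oplus>\<^bsub>R\<^esub> y) \<otimes>\<^bsub>R\<^esub> (a \<oplus>\<^bsub>R\<^esub> y))" and ?b2 = "(y, y \<otimes>\<^bsub>R\<^esub> y)"
    \<comment> \<open>Solving for \<open>c\<close> turns the choice of \<open>y\<close> into a
      rewrite rule that leaves only products of \<open>a\<close> and \<open>y\<close>.\<close>
    have c_eq: "c = a \<otimes>\<^bsub>R\<^esub> a \<oplus>\<^bsub>R\<^esub> y \<otimes>\<^bsub>R\<^esub> a"
      using c aa by (simp add: ya minus_eq a_ac r_neg1 r_neg2 r_neg)
    have b: "?b1 \<in> ?B" "?b2 \<in> ?B"
      using a' y by auto
    \<comment> \<open>The term \<open>a\<close> times \<open>y\<close> comes from the twist in the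
      group law, \<open>y\<close> times \<open>a\<close> from \<open>c_eq\<close>; no commutativity
      of the product is involved.\<close>
    have "?b1 = (a, c) \<otimes>\<^bsub>star_group R\<^esub> ?b2"
      using a' y by (simp add: star_group_def c_eq l_distr r_distr m_closed a_ac)
    moreover have "(a, c) \<in> carrier (star_group R)"
      using a c A by blast
    \<comment> \<open>Right multiplication by \<open>?b2\<close> cancels its inverse, so the
      explicit formula for inverses never enters.\<close>
    ultimately have "(a, c) = ?b1 \<otimes>\<^bsub>star_group R\<^esub> inv\<^bsub>star_group R\<^esub> ?b2"
      using b B by (subst S.inv_solve_right) blast+
    with b show ?thesis by blast
  qed
  with A B show ?thesis
    unfolding difference_basis_def by blast
qed

end
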